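(* Let $\mathfrak{g}$ be a finite-dimensional quadratic Lie algebra over $\mathbb{C}$. Let $m$ and $n$ be natural numbers with $m<n$ and let $\mathbf{x}$ be an element of $\mathfrak{g}_\infty$ such that $\operatorname{mod}_{m,n}(\mathbf{x})=(n-m)\chi(\mathfrak{g})$. Then for all natural numbers $n'\geq m$, $$\operatorname{mod}_{m,n'}(\mathbf{x})=(n'-m)\chi(\mathfrak{g}).$$
   Context: Natural numbers include $0$. A Lie algebra is quadratic if it admits a non-degenerate symmetric bilinear form $K$ that is invariant, i.e. $K([x,y],z)=K(x,[y,z])$ for all $x,y,z$. For a finite-dimensional complex Lie algebra $\mathfrak{g}$, let $\mathfrak{g}_\infty=\mathfrak{g}\otimes\mathbb{C}[T]$ be the Lie algebra with bracket extended $\mathbb{C}[T]$-bilinearly; its elements are written $\mathbf{x}=\sum_{k\in\mathbb{N}}x_k\otimes T^k$ with $x_k\in\mathfrak{g}$ (finitely many nonzero). For $m\in\mathbb{N}$ let $\mathfrak{g}_m=\mathfrak{g}_\infty/(\mathfrak{g}\otimes T^{m+1}\mathbb{C}[T])$ (the $m$-th generalized Takiff Lie algebra; $\mathfrak{g}_0=\mathfrak{g}$), and let $\mathbf{x}(m)=(x_0,\dots,x_m)$ be the image of $\mathbf{x}$ in $\mathfrak{g}_m$. For an element $z$ of a Lie algebra $\mathfrak{h}$, $\mathfrak{h}^z$ is its centralizer in $\mathfrak{h}$; for $f\in\mathfrak{h}^*$, $\mathfrak{h}^f=\{y\in\mathfrak{h}: f([y,\mathfrak{h}])=0\}$. The index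 of $\mathfrak{h}$ is $\chi(\mathfrak{h})=\min_{f\in\mathfrak{h}^*}\dim\mathfrak{h}^f$. For $m\le n$ in $\mathbb{N}$ and $\mathbf{x}\in\mathfrak{g}_\infty$, the $(m,n)$-modality of $\mathbf{x}$ is $$\operatorname{mod}_{m,n}(\mathbf{x})=\min_{\mathbf{y}\in\mathfrak{g}_\infty,\ \mathbf{y}(m)=\mathbf{x}(m)}\dim\mathfrak{g}_n^{\mathbf{y}(n)}-\dim\mathfrak{g}_m^{\mathbf{x}(m)}.$$ *)

theory Defs
  imports Complex_Main "HOL-Computational_Algebra.Polynomial"
begin

locale complex_lie_algebra = vector_space scale
  for scale :: "complex \<Rightarrow> 'a::ab_group_add \<Rightarrow> 'a" +
  fixes bracket :: "'a \<Rightarrow> 'a \<Rightarrow> 'a"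
  assumes linear_bracket_left: "Vector_Spaces.linear scale scale (\<lambda>x. bracket x y)"
    and linear_bracket_right: "Vector_Spaces.linear scale scale (\<lambda>y. bracket x y)"
    and bracket_self: "bracket x x = 0"
    and jacobi: "bracket x (bracket y z) + bracket y (bracket z x) + bracket z (bracket x y) = 0"

definition quadratic_lie_algebra ::
    "(complex \<Rightarrow> 'a::ab_group_add \<Rightarrow> 'a) \<Rightarrow> ('a \<Rightarrow> 'a \<Rightarrow> 'a) \<Rightarrow> bool" where
  "quadratic_lie_algebra scale bracket \<longleftrightarrow>
     complex_lie_algebra scale bracket \<and>
     (\<exists>K :: 'a \<Rightarrow> 'a \<Rightarrow> complex.
        (\<forall>y. Vector_Spaces.linear scale (*) (\<lambda>x. K x y)) \<and>
        (\<forall>x. Vector_Spaces.linear scale (*) (\<lambda>y. K x y)) \<and>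
        (\<forall>x y. K x y = K y x) \<and>
        (\<forall>x. (\<forall>y. K x y = 0) \<longrightarrow> x = 0) \<and>
        (\<forall>x y z. K (bracket x y) z = K x (bracket y z)))"

definition form_stabilizer :: "('a \<Rightarrow> 'a \<Rightarrow> 'a) \<Rightarrow> ('a \<Rightarrow> complex) \<Rightarrow> 'a set" where
  "form_stabilizer bracket f = {y. \<forall>z. f (bracket y z) = 0}"

text \<open>The infimum of a nonempty set of natural numbers is its minimum; the zero form shows
  that the set below is nonempty.\<close>

definition lie_index ::
    "(complex \<Rightarrow> 'a::ab_group_add \<Rightarrow> 'a) \<Rightarrow> ('a \<Rightarrow> 'a \<Rightarrow> 'a) \<Rightarrow> nat" where
  "lie_index scale bracket =
     (INF f\<in>{f. Vector_Spaces.linear scale (*) f}.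
        vector_space.dim scale (form_stabilizer bracket f))"

text \<open>The space \<open>\<gg> \<otimes> \<complex>[T]\<close> is modelled by the type of polynomials with
  coefficients in \<open>\<gg>\<close>: the coefficient of index \<open>k\<close> of \<open>x\<close> is the component \<open>x\<^sub>k\<close>,
  and \<open>monom a k\<close> is \<open>a \<otimes> T\<^sup>k\<close>.\<close>

definition current_scale ::
    "(complex \<Rightarrow> 'a::ab_group_add \<Rightarrow> 'a) \<Rightarrow> complex \<Rightarrow> 'a poly \<Rightarrow> 'a poly" where
  "current_scale scale c = map_poly (scale c)"

definition current_bracket ::
    "('a::ab_group_add \<Rightarrow> 'a \<Rightarrow> 'a) \<Rightarrow> 'a poly \<Rightarrow> 'a poly \<Rightarrow> 'a poly" where
  "current_bracket bracket x y =
     (\<Sum>i\<le>degree x. \<Sum>j\<le>degree y. monom (bracket (coeff x i) (coeff y j)) (i + j))"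

text \<open>The quotient of \<open>\<gg> \<otimes> \<complex>[T]\<close> by \<open>\<gg> \<otimes> T\<^bsup>m+1\<^esup>\<complex>[T]\<close> is realised on
  the tuples \<open>(x\<^sub>0, \<dots>, x\<^sub>m)\<close>, i.e. on the polynomials of degree at most \<open>m\<close>, the quotient
  map being truncation. The lemmas at the end of this theory show that truncation is linear and
  onto, with the right kernel, and that it carries the bracket to \<open>takiff_bracket m\<close>.\<close>

definition takiff :: "nat \<Rightarrow> 'a::ab_group_add poly set" where
  "takiff m = {x. degree x \<le> m}"

definition takiff_proj :: "nat \<Rightarrow> 'a::ab_group_add poly \<Rightarrow> 'a poly" where
  "takiff_proj m x = poly_cutoff (Suc m) x"

definition takiff_bracket ::
    "nat \<Rightarrow> ('a::ab_group_add \<Rightarrow> 'a \<Rightarrow> 'a) \<Rightarrow> 'a poly \<Rightarrow> 'a poly \<Rightarrow> 'a poly" where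
  "takiff_bracket m bracket x y = takiff_proj m (current_bracket bracket x y)"

definition takiff_centralizer ::
    "nat \<Rightarrow> ('a::ab_group_add \<Rightarrow> 'a \<Rightarrow> 'a) \<Rightarrow> 'a poly \<Rightarrow> 'a poly set" where
  "takiff_centralizer m bracket z = {y \<in> takiff m. takiff_bracket m bracket z y = 0}"

text \<open>The difference is taken in the integers, to avoid truncated subtraction.\<close>

definition modality ::
    "(complex \<Rightarrow> 'a::ab_group_add \<Rightarrow> 'a) \<Rightarrow> ('a \<Rightarrow> 'a \<Rightarrow> 'a) \<Rightarrow> nat \<Rightarrow> nat \<Rightarrow> 'a poly \<Rightarrow> int" where
  "modality scale bracket m n x =
     int (INF y\<in>{y. takiff_proj m y = takiff_proj m x}.
            vector_space.dim (current_scale scale)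
              (takiff_centralizer n bracket (takiff_proj n y))) -
     int (vector_space.dim (current_scale scale)
            (takiff_centralizer m bracket (takiff_proj m x)))"

lemma coeff_takiff_proj: "coeff (takiff_proj m x) k = (if k \<le> m then coeff x k else 0)"
  by (simp add: takiff_proj_def coeff_poly_cutoff less_Suc_eq_le)

lemma takiff_proj_add: "takiff_proj m (x + y) = takiff_proj m x + takiff_proj m y"
  by (rule poly_eqI) (simp add: coeff_takiff_proj)

lemma takiff_proj_eq_0_iff: "takiff_proj m x = 0 \<longleftrightarrow> (\<forall>k\<le>m. coeff x k = 0)"
  by (auto simp: poly_eq_iff coeff_takiff_proj)

lemma range_takiff_proj: "range (takiff_proj m) = (takiff m :: 'a::ab_group_add poly set)"
proof
  show "range (takiff_proj m) \<subseteq> takiff m"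
    by (auto simp: takiff_def coeff_takiff_proj intro!: degree_le)
next
  show "(takiff m :: 'a poly set) \<subseteq> range (takiff_proj m)"
  proof
    fix x :: "'a poly" assume "x \<in> takiff m"
    then have "takiff_proj m x = x"
      by (auto simp: poly_eq_iff takiff_def coeff_takiff_proj coeff_eq_0)
    then show "x \<in> range (takiff_proj m)" by (intro image_eqI[of x _ x]) simp_all
  qed
qed

context complex_lie_algebra
begin

lemma bracket_0_left [simp]: "bracket 0 y = 0"
  using module_hom.zero[of scale scale "\<lambda>x. bracket x y"] linear_bracket_left[of y]
  by (simp add: linear_iff_module_hom)

lemma bracket_0_right [simp]: "bracket x 0 = 0"
  using module_hom.zero[of scale scale "\<lambda>y. bracket x y"] linear_bracket_right[of x]
  by (simp add: linear_iff_module_hom)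

lemma coeff_current_scale: "coeff (current_scale scale c x) k = scale c (coeff x k)"
  by (simp add: current_scale_def coeff_map_poly)

lemma vector_space_current_scale: "vector_space (current_scale scale)"
  by unfold_locales
    (auto intro!: poly_eqI simp: coeff_current_scale scale_right_distrib scale_left_distrib)

lemma takiff_proj_scale:
  "takiff_proj m (current_scale scale c x) = current_scale scale c (takiff_proj m x)"
  by (rule poly_eqI) (simp add: coeff_takiff_proj coeff_current_scale)

lemma coeff_current_bracket:
  "coeff (current_bracket bracket x y) k = (\<Sum>i\<le>k. bracket (coeff x i) (coeff y (k - i)))"
proof -
  have inner: "(\<Sum>j\<le>degree y. coeff (monom (bracket (coeff x i) (coeff y j)) (i + j)) k) =
      (if i \<le> k then bracket (coeff x i) (coeff y (k - i)) else 0)" for i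
  proof (cases "i \<le> k")
    case True
    then have "(\<Sum>j\<le>degree y. coeff (monom (bracket (coeff x i) (coeff y j)) (i + j)) k) =
        (\<Sum>j\<le>degree y. if k - i = j then bracket (coeff x i) (coeff y j) else 0)"
      by (intro sum.cong) auto
    also have "\<dots> = bracket (coeff x i) (coeff y (k - i))"
      by (simp add: sum.delta' coeff_eq_0)
    finally show ?thesis using True by simp
  next
    case False
    then show ?thesis by (auto intro!: sum.neutral)
  qed
  have "coeff (current_bracket bracket x y) k =
      (\<Sum>i\<le>degree x. if i \<le> k then bracket (coeff x i) (coeff y (k - i)) else 0)"
    by (simp only: current_bracket_def coeff_sum inner)
  also have "\<dots> = (\<Sum>i\<in>{..degree x} \<inter> {..k}. bracket (coeff x i) (coeff y (k - i)))"
    by (subst sum.inter_restrict) simp_all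
  also have "\<dots> = (\<Sum>i\<le>k. bracket (coeff x i) (coeff y (k - i)))"
    by (intro sum.mono_neutral_left) (auto simp: coeff_eq_0 not_le[symmetric] intro: ccontr)
  finally show ?thesis .
qed

lemma takiff_proj_bracket:
  "takiff_proj m (current_bracket bracket x y) =
     takiff_bracket m bracket (takiff_proj m x) (takiff_proj m y)"
  by (rule poly_eqI)
    (auto simp: takiff_bracket_def coeff_takiff_proj coeff_current_bracket intro!: sum.cong)

end

end

theory Submission
  imports Defs
begin

text \<open>
  Fix \<open>y\<close> in \<open>\<gg> \<otimes> \<complex>[T]\<close> and let \<open>Z\<^sub>n\<close> be the centralizer of \<open>y(n)\<close> in \<open>\<gg>\<^sub>n\<close>, with \<open>d = dim \<gg>\<close>.
  Multiplication by \<open>T\<close> maps \<open>Z\<^sub>n\<close> isomorphically onto the elements of \<open>Z\<^bsub>n+1\<^esub>\<close> with zero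
  constant term. So, if \<open>E\<^sub>n \<subseteq> \<gg>\<close> denotes the space of constant terms of elements of \<open>Z\<^sub>n\<close>, then
  \<open>dim Z\<^sub>n = dim E\<^sub>0 + \<dots> + dim E\<^sub>n\<close>. Truncation shows that the \<open>E\<^sub>n\<close> decrease with \<open>n\<close>, that is,
  \<open>dim Z\<^sub>n\<close> is a concave function of \<open>n\<close>.

  Every increment of this function is at least \<open>\<chi>(\<gg>)\<close> (lemma \<open>dim_centralizer_const_ge\<close>).
  The invariant form identifies \<open>\<gg>\<close> with its dual and centralizers with stabilizers of linear
  forms, so all centralizers in \<open>\<gg>\<close> have dimension at least \<open>\<chi>(\<gg>)\<close> and every \<open>ad a\<close> has rank at most
  \<open>d - \<chi>(\<gg>)\<close>. For \<open>z\<close> of degree at most \<open>n\<close>, the polynomial \<open>[y, z]\<close> vanishes as soon as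
  \<open>[y(t), z(t)] = 0\<close> at \<open>n + deg y + 1\<close> distinct points \<open>t\<close>. Each point imposes at most \<open>d - \<chi>(\<gg>)\<close> linear
  conditions on the \<open>(n + 1) d\<close>-dimensional space of such \<open>z\<close>, so
  \<open>dim Z\<^sub>n \<ge> (n + 1) \<chi>(\<gg>) - deg y (d - \<chi>(\<gg>))\<close> (lemma \<open>dim_centralizer_upto_ge\<close>).
  A concave function with a lower bound of this slope has no increment below \<open>\<chi>(\<gg>)\<close>.

  Now choose \<open>y\<close> attaining \<open>mod\<^bsub>m,n\<^esub>(x) = (n - m) \<chi>(\<gg>)\<close>. The \<open>n - m\<close> increments after \<open>m\<close> are all at
  least \<open>\<chi>(\<gg>)\<close> and add up to \<open>(n - m) \<chi>(\<gg>)\<close>, so the first of them, \<open>dim E\<^bsub>m+1\<^esub>\<close>, equals \<open>\<chi>(\<gg>)\<close>; by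
  monotonicity so do all later ones. The same \<open>y\<close> therefore attains the lower bound for every \<open>n'\<close>.
\<close>

section \<open>Rank and nullity on a finite-dimensional subspace\<close>

lemma (in vector_space) span_Int_span_independent:
  assumes "independent (A \<union> C)" and "A \<inter> C = {}"
  shows "span A \<inter> span C = {0}"
proof -
  have "x = 0" if "x \<in> span A" "x \<in> span C" for x
  proof -
    have x: "x \<in> span (A \<union> C)"
      using that(1) span_mono[of A "A \<union> C"] by auto
    have "representation (A \<union> C) x = representation A x"
      "representation (A \<union> C) x = representation C x"
      by (intro representation_extend assms that; simp)+
    then have "representation (A \<union> C) x b = 0" for b
      using assms(2) representation_ne_zero[of A x b] representation_ne_zero[of C x b] by fastforce
    then show "x = 0"
      using sum_nonzero_representation_eq[OF assms(1) x] by simp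
  qed
  then show ?thesis
    using span_zero by blast
qed

lemma (in vector_space) dim_mono_finite_span:
  assumes "S \<subseteq> T" and "T \<subseteq> span W" and "finite W"
  shows "dim S \<le> dim T"
proof -
  obtain B where B: "B \<subseteq> T" "independent B" "T \<subseteq> span B" "card B = dim T"
    using basis_exists by blast
  have "finite B"
    using independent_span_bound[OF assms(3) B(2)] B(1) assms(2) by blast
  then show ?thesis
    using dim_le_card[of S B] B assms(1) by auto
qed

text \<open>Rank-nullity on a subspace: both ambient spaces may have infinite dimension, as
  \<open>\<gg> \<otimes> \<complex>[T]\<close> does; only the subspace has to be finite-dimensional. A basis \<open>A\<close> of the kernel is
  extended by \<open>C\<close> to a basis of the subspace, and \<open>C\<close> is mapped to a basis of the image.\<close>

lemma (in Vector_Spaces.linear) dim_eq_dim_kernel_plus_dim_image: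
  assumes S: "vs1.subspace S" and W: "S \<subseteq> vs1.span W" "finite W"
  shows "vs1.dim S = vs1.dim (S \<inter> {x. f x = 0}) + vs2.dim (f ` S)"
proof -
  let ?N = "S \<inter> {x. f x = 0}"
  obtain A where A: "A \<subseteq> ?N" "vs1.independent A" "?N \<subseteq> vs1.span A" "card A = vs1.dim ?N"
    using vs1.basis_exists by blast
  obtain B where B: "A \<subseteq> B" "B \<subseteq> S" "vs1.independent B" "S \<subseteq> vs1.span B"
    using vs1.maximal_independent_subset_extend[of A S] A by blast
  define C where "C = B - A"
  have fin: "finite B"
    using vs1.independent_span_bound[OF W(2) B(3)] B(2) W(1) by blast
  have BAC: "B = A \<union> C" "A \<inter> C = {}"
    using B(1) by (auto simp: C_def)
  have spanC: "vs1.span C \<subseteq> S"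
    using B(2) S by (intro vs1.span_minimal) (auto simp: C_def)
  have inj: "inj_on f (vs1.span C)"
    unfolding inj_on_iff_eq_0[OF vs1.subspace_span]
  proof (intro ballI impI)
    fix x assume x: "x \<in> vs1.span C" "f x = 0"
    then have "x \<in> vs1.span A"
      using spanC A(3) by blast
    then show "x = 0"
      using vs1.span_Int_span_independent[of A C] B(3) BAC x(1) by blast
  qed
  have "vs1.independent C"
    using B(3) vs1.independent_mono C_def by blast
  then have ind: "vs2.independent (f ` C)"
    using inj by (rule independent_injective_image)
  have "f ` B \<subseteq> insert 0 (f ` C)"
    using A(1) BAC by auto
  then have "f ` S \<subseteq> vs2.span (f ` C)"
    using spans_image[OF B(4)] vs2.span_mono[of "f ` B" "insert 0 (f ` C)"] vs2.span_insert_0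
    by fastforce
  then have "vs2.dim (f ` S) = card (f ` C)"
    using ind B(2) by (intro vs2.dim_unique) (auto simp: C_def)
  also have "\<dots> = card C"
    using inj inj_on_subset vs1.span_superset by (intro card_image) blast
  finally have "vs2.dim (f ` S) = card C" .
  moreover have "vs1.dim S = card B"
    using B by (intro vs1.dim_unique) auto
  moreover have "card B = card A + card C"
    using fin BAC by (metis card_Un_disjoint finite_Un)
  ultimately show ?thesis
    using A(4) by simp
qed

section \<open>Constant terms of the centralizers in the Takiff algebras\<close>

locale finite_dimensional_lie_algebra =
  finite_dimensional_vector_space scale Basis + complex_lie_algebra scale bracket
  for scale :: "complex \<Rightarrow> 'a::ab_group_add \<Rightarrow> 'a" and Basis bracket
begin

sublocale current: vector_space "current_scale scale"
  by (rule vector_space_current_scale)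

text \<open>The names \<open>Z\<^sub>n\<close> and \<open>E\<^sub>n\<close> in the explanations stand for the following two spaces.\<close>

abbreviation centralizer_upto :: "nat \<Rightarrow> 'a poly \<Rightarrow> 'a poly set" where
  "centralizer_upto n y \<equiv> takiff_centralizer n bracket (takiff_proj n y)"

definition centralizer_const :: "nat \<Rightarrow> 'a poly \<Rightarrow> 'a set" where
  "centralizer_const n y = (\<lambda>z. coeff z 0) ` centralizer_upto n y"

lemma mem_centralizer_upto:
  "z \<in> centralizer_upto n y \<longleftrightarrow>
     degree z \<le> n \<and> (\<forall>k\<le>n. coeff (current_bracket bracket y z) k = 0)"
proof -
  have "takiff_bracket n bracket (takiff_proj n y) z = takiff_proj n (current_bracket bracket y z)"
    if "degree z \<le> n"
  proof -
    have "takiff_proj n z = z"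
      using that by (auto simp: poly_eq_iff coeff_takiff_proj coeff_eq_0)
    then show ?thesis
      by (simp add: takiff_proj_bracket)
  qed
  then show ?thesis
    by (auto simp: takiff_centralizer_def takiff_def takiff_proj_eq_0_iff)
qed

lemma linear_bracket: "Vector_Spaces.linear scale scale (bracket a)"
  using linear_bracket_right[of a] by simp

lemmas bracket_add_right = module_hom.add[OF linear_bracket_right[folded module_hom_iff_linear]]
lemmas bracket_scale_right = module_hom.scale[OF linear_bracket_right[folded module_hom_iff_linear]]
lemmas bracket_sum_right = module_hom.sum[OF linear_bracket_right[folded module_hom_iff_linear]]
lemmas bracket_scale_left = module_hom.scale[OF linear_bracket_left[folded module_hom_iff_linear]]
lemmas bracket_sum_left = module_hom.sum[OF linear_bracket_left[folded module_hom_iff_linear]]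

lemma subspace_centralizer_upto: "current.subspace (centralizer_upto n y)"
proof -
  have "degree (current_scale scale c z) \<le> n" if "degree z \<le> n" for c z
    using that by (intro degree_le) (auto simp: coeff_current_scale coeff_eq_0)
  then show ?thesis
    by (auto simp: current.subspace_def mem_centralizer_upto coeff_current_bracket
        coeff_current_scale bracket_add_right bracket_scale_right sum.distrib degree_add_le
        simp flip: scale_sum_right)
qed

lemma takiff_finite_span:
  "\<exists>W. finite W \<and> takiff n \<subseteq> current.span W"
proof (intro exI conjI)
  let ?W = "(\<lambda>(b, k). monom b k) ` (Basis \<times> {..n})"
  show "finite ?W"
    using finite_Basis by auto
  show "takiff n \<subseteq> current.span ?W"
  proof
    fix z :: "'a poly" assume "z \<in> takiff n"
    then have deg: "degree z \<le> n"
      by (simp add: takiff_def)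
    have "monom a k \<in> current.span ?W" if "k \<le> n" for a k
    proof -
      have "monom (\<Sum>b\<in>Basis. scale (representation Basis a b) b) k =
          (\<Sum>b\<in>Basis. current_scale scale (representation Basis a b) (monom b k))"
        by (rule poly_eqI) (simp add: coeff_sum coeff_current_scale)
      moreover have "(\<Sum>b\<in>Basis. scale (representation Basis a b) b) = a"
        by (rule sum_representation_eq) (auto simp: independent_Basis finite_Basis span_Basis)
      moreover have "(\<Sum>b\<in>Basis. current_scale scale (representation Basis a b) (monom b k))
          \<in> current.span ?W"
        using that by (intro current.span_sum current.span_scale current.span_base) force
      ultimately show ?thesis by simp
    qed
    then have "(\<Sum>k\<le>n. monom (coeff z k) k) \<in> current.span ?W"
      by (intro current.span_sum) auto
    then show "z \<in> current.span ?W"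
      using poly_as_sum_of_monoms'[OF deg] by simp
  qed
qed

lemma centralizer_upto_finite_span:
  obtains W where "finite W" and "centralizer_upto n y \<subseteq> current.span W"
  using takiff_finite_span[of n] by (auto simp: takiff_centralizer_def)

lemma linear_coeff: "Vector_Spaces.linear (current_scale scale) scale (\<lambda>z. coeff z k)"
  unfolding Vector_Spaces.linear_iff
  using vector_space_axioms vector_space_current_scale by (auto simp: coeff_current_scale)

lemma linear_shift: "Vector_Spaces.linear (current_scale scale) (current_scale scale) (pCons 0)"
  unfolding Vector_Spaces.linear_iff
  using vector_space_current_scale
  by (auto simp: poly_eq_iff coeff_current_scale coeff_pCons split: nat.splits)

text \<open>The bracket is \<open>\<complex>[T]\<close>-bilinear, and \<open>pCons 0\<close> is multiplication by \<open>T\<close>: the next two lemmas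
  compare coefficients in \<open>[y, Tz] = T[y, z]\<close>.\<close>

lemma coeff_bracket_shift:
  "coeff (current_bracket bracket y (pCons 0 z)) (Suc k) = coeff (current_bracket bracket y z) k"
  by (auto simp: coeff_current_bracket Suc_diff_le intro!: sum.cong)

lemma coeff_bracket_shift_0: "coeff (current_bracket bracket y (pCons 0 z)) 0 = 0"
  by (simp add: coeff_current_bracket)

lemma all_le_Suc_iff: "(\<forall>k\<le>Suc n. P k) \<longleftrightarrow> P 0 \<and> (\<forall>k\<le>n. P (Suc k))"
  by (metis Suc_le_mono le0 not0_implies_Suc)

text \<open>Since \<open>[y, Tw] = T[y, w]\<close>, the element \<open>Tw\<close> commutes with \<open>y\<close> modulo \<open>T\<^bsup>n+2\<^esup>\<close> exactly when
  \<open>w\<close> commutes with \<open>y\<close> modulo \<open>T\<^bsup>n+1\<^esup>\<close>.\<close>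

lemma centralizer_upto_Suc_Int_const_0:
  "centralizer_upto (Suc n) y \<inter> {z. coeff z 0 = 0} = pCons 0 ` centralizer_upto n y"
proof -
  have "pCons 0 w \<in> centralizer_upto (Suc n) y \<longleftrightarrow> w \<in> centralizer_upto n y" for w
  proof -
    have "degree (pCons 0 w) \<le> Suc n \<longleftrightarrow> degree w \<le> n"
      by (cases "w = 0") auto
    then show ?thesis
      by (simp add: mem_centralizer_upto all_le_Suc_iff
          coeff_bracket_shift coeff_bracket_shift_0)
  qed
  moreover have "\<exists>w. z = pCons 0 w" if "coeff z 0 = 0" for z :: "'a poly"
    using that by (cases z) auto
  ultimately show ?thesis
    by fastforce
qed

text \<open>Rank-nullity for the map taking an element to its constant term, whose kernel is a shifted
  copy of the previous centralizer.\<close>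

lemma dim_centralizer_upto_Suc:
  "current.dim (centralizer_upto (Suc n) y) =
     current.dim (centralizer_upto n y) + dim (centralizer_const (Suc n) y)"
proof -
  interpret c: Vector_Spaces.linear "current_scale scale" scale "\<lambda>z. coeff z 0"
    by (rule linear_coeff)
  interpret s: Vector_Spaces.linear "current_scale scale" "current_scale scale" "pCons 0"
    by (rule linear_shift)
  obtain V where V: "finite V" "centralizer_upto n y \<subseteq> current.span V"
    using centralizer_upto_finite_span .
  obtain W where W: "finite W" "centralizer_upto (Suc n) y \<subseteq> current.span W"
    using centralizer_upto_finite_span .
  have "centralizer_upto n y \<inter> {z. pCons 0 z = 0} = {0}"
    using current.subspace_0[OF subspace_centralizer_upto] by auto
  then have "current.dim (pCons 0 ` centralizer_upto n y) = current.dim (centralizer_upto n y)"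
    using s.dim_eq_dim_kernel_plus_dim_image[OF subspace_centralizer_upto V(2,1)]
      current.dim_le_card[of "{0}" "{}"] by auto
  then show ?thesis
    using c.dim_eq_dim_kernel_plus_dim_image[OF subspace_centralizer_upto W(2,1)]
    by (simp add: centralizer_upto_Suc_Int_const_0 centralizer_const_def)
qed

lemma dim_centralizer_upto_0:
  "current.dim (centralizer_upto 0 y) = dim (centralizer_const 0 y)"
proof -
  interpret c: Vector_Spaces.linear "current_scale scale" scale "\<lambda>z. coeff z 0"
    by (rule linear_coeff)
  obtain W where W: "finite W" "centralizer_upto 0 y \<subseteq> current.span W"
    using centralizer_upto_finite_span .
  have "z = 0" if "z \<in> centralizer_upto 0 y" "coeff z 0 = 0" for z
    using that leading_coeff_0_iff[of z] unfolding mem_centralizer_upto by simp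
  then have "centralizer_upto 0 y \<inter> {z. coeff z 0 = 0} = {0}"
    using current.subspace_0[OF subspace_centralizer_upto] by auto
  then show ?thesis
    using c.dim_eq_dim_kernel_plus_dim_image[OF subspace_centralizer_upto W(2,1)]
      current.dim_le_card[of "{0}" "{}"]
    by (simp add: centralizer_const_def)
qed

lemma dim_centralizer_upto_eq_sum:
  "current.dim (centralizer_upto n y) = (\<Sum>k\<le>n. dim (centralizer_const k y))"
  by (induction n) (simp_all add: dim_centralizer_upto_0 dim_centralizer_upto_Suc)

text \<open>The truncation \<open>\<gg>\<^bsub>n+1\<^esub> \<rightarrow> \<gg>\<^sub>n\<close> maps centralizer into centralizer and keeps constant terms.\<close>

lemma centralizer_const_Suc_subset: "centralizer_const (Suc n) y \<subseteq> centralizer_const n y"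
proof
  fix a assume "a \<in> centralizer_const (Suc n) y"
  then obtain z where z: "z \<in> centralizer_upto (Suc n) y" "a = coeff z 0"
    by (auto simp: centralizer_const_def)
  have "degree (takiff_proj n z) \<le> n"
    by (intro degree_le) (simp add: coeff_takiff_proj)
  moreover have "coeff (current_bracket bracket y (takiff_proj n z)) k =
      coeff (current_bracket bracket y z) k" if "k \<le> n" for k
    using that by (auto simp: coeff_current_bracket coeff_takiff_proj intro!: sum.cong)
  ultimately have "takiff_proj n z \<in> centralizer_upto n y"
    using z(1) by (simp add: mem_centralizer_upto)
  then show "a \<in> centralizer_const n y"
    using z(2) unfolding centralizer_const_def
    by (intro image_eqI[of _ _ "takiff_proj n z"]) (simp_all add: coeff_takiff_proj)
qed

lemma dim_centralizer_const_antimono: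
  "j \<le> k \<Longrightarrow> dim (centralizer_const k y) \<le> dim (centralizer_const j y)"
  using lift_Suc_antimono_le[of "\<lambda>k. centralizer_const k y"] centralizer_const_Suc_subset
  by (intro dim_subset) blast

section \<open>A lower bound by evaluation at points\<close>

text \<open>Evaluation at \<open>T = t\<close>, the Lie algebra homomorphism from \<open>\<gg> \<otimes> \<complex>[T]\<close> to \<open>\<gg>\<close>. It
  differs from \<open>poly\<close> in that the point is a scalar and the coefficients are vectors.\<close>

definition eval_current :: "complex \<Rightarrow> 'a poly \<Rightarrow> 'a" where
  "eval_current t z = (\<Sum>k\<le>degree z. scale (t ^ k) (coeff z k))"

lemma eval_current_eq:
  assumes "degree z \<le> n"
  shows "eval_current t z = (\<Sum>k\<le>n. scale (t ^ k) (coeff z k))"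
  unfolding eval_current_def using assms
  by (intro sum.mono_neutral_left) (auto simp: coeff_eq_0)

lemma linear_eval_current: "Vector_Spaces.linear (current_scale scale) scale (eval_current t)"
proof -
  have "eval_current t (z + w) = eval_current t z + eval_current t w" for z w
  proof -
    define n where "n = max (degree z) (degree w)"
    have "degree z \<le> n" "degree w \<le> n" "degree (z + w) \<le> n"
      by (simp_all add: n_def degree_add_le_max)
    then show ?thesis
      by (simp add: eval_current_eq scale_right_distrib sum.distrib)
  qed
  moreover have "eval_current t (current_scale scale c z) = scale c (eval_current t z)" for c z
  proof -
    have "degree (current_scale scale c z) \<le> degree z"
      by (intro degree_le) (simp add: coeff_current_scale coeff_eq_0)
    then show ?thesis
      by (simp add: eval_current_eq[of _ "degree z"] coeff_current_scale scale_sum_right mult.commute)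
  qed
  ultimately show ?thesis
    unfolding Vector_Spaces.linear_iff
    using vector_space_axioms vector_space_current_scale by blast
qed

lemma eval_current_monom: "eval_current t (monom a k) = scale (t ^ k) a"
proof -
  have "eval_current t (monom a k) = (\<Sum>i\<le>k. if k = i then scale (t ^ i) a else 0)"
    unfolding eval_current_eq[OF degree_monom_le] by (intro sum.cong) auto
  then show ?thesis by simp
qed

lemma eval_current_bracket:
  "eval_current t (current_bracket bracket y z) = bracket (eval_current t y) (eval_current t z)"
proof -
  interpret e: Vector_Spaces.linear "current_scale scale" scale "eval_current t"
    by (rule linear_eval_current)
  show ?thesis
    by (simp add: current_bracket_def e.sum eval_current_monom)
      (simp add: eval_current_def bracket_sum_left bracket_sum_right bracket_scale_left
        bracket_scale_right power_add scale_sum_right mult.commute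
        sum.swap[of _ "{..degree z}"])
qed

text \<open>In each coordinate of \<open>\<gg>\<close> this is the bound on the number of roots of a complex
  polynomial.\<close>

lemma eq_0_if_eval_current_eq_0:
  assumes "finite P" and "degree z < card P" and zero: "\<And>t. t \<in> P \<Longrightarrow> eval_current t z = 0"
  shows "z = 0"
proof (rule poly_eqI)
  fix k
  have "representation Basis (coeff z k) b = 0" if "b \<in> Basis" for b
  proof -
    let ?r = "\<lambda>v. representation Basis v b"
    define p where "p = (\<Sum>k\<le>degree z. monom (?r (coeff z k)) k)"
    have sp: "v \<in> span Basis" for v by (simp add: span_Basis)
    have "poly p t = 0" if "t \<in> P" for t
    proof -
      have "poly p t = (\<Sum>k\<le>degree z. t ^ k * ?r (coeff z k))"
        by (simp add: p_def poly_sum poly_monom mult.commute)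
      also have "\<dots> = ?r (eval_current t z)"
        by (simp add: eval_current_def representation_sum[OF independent_Basis sp]
            representation_scale[OF independent_Basis sp])
      finally show ?thesis
        by (simp add: zero[OF that] representation_zero)
    qed
    moreover have "degree p < card P"
    proof -
      have "degree p \<le> degree z"
        unfolding p_def by (intro degree_sum_le) (auto intro: order_trans[OF degree_monom_le])
      then show ?thesis using assms(2) by simp
    qed
    ultimately have "p = 0"
      using assms(1) card_mono[of "{t. poly p t = 0}" P] poly_roots_finite[of p]
        card_poly_roots_bound[of p] by fastforce
    then have "coeff p k = 0" by simp
    moreover have "coeff p k = (if k \<le> degree z then ?r (coeff z k) else 0)"
      by (simp add: p_def coeff_sum)
    ultimately show ?thesis
      by (auto simp: coeff_eq_0 representation_zero split: if_splits)
  qed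
  then have "(\<Sum>b\<in>Basis. scale (representation Basis (coeff z k) b) b) = 0"
    by simp
  then show "coeff z k = coeff 0 k"
    using sum_representation_eq[of Basis "coeff z k" Basis]
    by (simp add: independent_Basis finite_Basis span_Basis)
qed

text \<open>This is the sum formula for the dimension of centralizers at \<open>y = 0\<close>, where the centralizer
  is the whole Takiff algebra and every element of \<open>\<gg>\<close> is a constant term.\<close>

lemma dim_takiff: "current.dim (takiff n) = Suc n * dimension"
proof -
  have "centralizer_upto k 0 = takiff k" for k
    by (auto simp: mem_centralizer_upto takiff_def current_bracket_def)
  moreover have "centralizer_const k 0 = UNIV" for k
  proof -
    have "a \<in> centralizer_const k 0" for a
      unfolding centralizer_const_def
      by (rule image_eqI[of _ _ "monom a 0"])
        (auto simp: mem_centralizer_upto current_bracket_def intro!: degree_le)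
    then show ?thesis by auto
  qed
  ultimately show ?thesis
    using dim_centralizer_upto_eq_sum[of n 0] by (simp add: dimension_def)
qed

lemma dim_bracket_image:
  "dim {z. bracket a z = 0} + dim (range (bracket a)) = dimension"
proof -
  interpret b: Vector_Spaces.linear scale scale "bracket a"
    by (rule linear_bracket)
  show ?thesis
    using b.dim_eq_dim_kernel_plus_dim_image[of UNIV Basis]
    by (simp add: span_Basis finite_Basis dimension_def)
qed

text \<open>Adding a point \<open>t\<close> to \<open>P\<close> passes to the kernel of \<open>z \<mapsto> [y(t), z(t)]\<close>, a map whose rank
  is at most that of \<open>ad y(t)\<close>, hence at most \<open>dim \<gg> - r\<close>.\<close>

lemma dim_evaluation_conditions:
  assumes "\<And>a. r \<le> dim {z. bracket a z = 0}" and "finite P"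
  shows "Suc n * dimension \<le>
    current.dim {z \<in> takiff n. \<forall>t\<in>P. bracket (eval_current t y) (eval_current t z) = 0}
      + card P * (dimension - r)"
  using assms(2)
proof (induction P rule: finite_induct)
  case empty
  then show ?case by (simp add: dim_takiff)
next
  case (insert t P)
  define S where
    "S = {z \<in> takiff n. \<forall>t\<in>P. bracket (eval_current t y) (eval_current t z) = 0}"
  let ?f = "bracket (eval_current t y) \<circ> eval_current t"
  have lin: "Vector_Spaces.linear (current_scale scale) scale (bracket (eval_current s y) \<circ> eval_current s)" for s
    by (rule Vector_Spaces.linear_compose[OF linear_eval_current linear_bracket])
  interpret f: Vector_Spaces.linear "current_scale scale" scale ?f
    by (rule lin)
  obtain W where W: "finite W" "takiff n \<subseteq> current.span W"
    using takiff_finite_span by blast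
  have tak: "current.subspace (takiff n)"
    using subspace_centralizer_upto[of n 0]
    by (simp add: takiff_centralizer_def takiff_bracket_def current_bracket_def
        takiff_proj_def)
  have S: "S = takiff n \<inter> (\<Inter>s\<in>P. {z. (bracket (eval_current s y) \<circ> eval_current s) z = 0})"
    by (auto simp: S_def)
  have sub: "current.subspace S"
    unfolding S
    by (intro current.subspace_inter tak current.subspace_Int
        module_hom.subspace_kernel[OF lin[folded module_hom_iff_linear]])
  have "current.dim S = current.dim (S \<inter> {z. ?f z = 0}) + dim (?f ` S)"
    using W by (intro f.dim_eq_dim_kernel_plus_dim_image[OF sub]) (auto simp: S_def)
  also have "dim (?f ` S) \<le> dim (range (bracket (eval_current t y)))"
    by (intro dim_subset) auto
  also have "\<dots> \<le> dimension - r"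
    using dim_bracket_image[of "eval_current t y"] assms(1)[of "eval_current t y"] by linarith
  finally have "current.dim S \<le> current.dim (S \<inter> {z. ?f z = 0}) + (dimension - r)"
    by simp
  moreover have "S \<inter> {z. ?f z = 0} =
      {z \<in> takiff n. \<forall>s\<in>insert t P. bracket (eval_current s y) (eval_current s z) = 0}"
    by (auto simp: S_def)
  ultimately show ?case
    using insert by (simp add: S_def)
qed

text \<open>Take \<open>n + deg y + 1\<close> points: more than the degree of \<open>[y, z]\<close>, so the conditions at these
  points force \<open>z\<close> to commute with \<open>y\<close>. Of the \<open>n + deg y + 1\<close> losses of \<open>dim \<gg> - r\<close>, all but
  \<open>deg y\<close> are absorbed in replacing \<open>(n + 1) dim \<gg>\<close> by \<open>(n + 1) r\<close>.\<close>

lemma dim_centralizer_upto_ge: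
  assumes "\<And>a. r \<le> dim {z. bracket a z = 0}"
  shows "Suc n * r \<le> current.dim (centralizer_upto n y) + degree y * (dimension - r)"
proof -
  define P where "P = (of_nat :: nat \<Rightarrow> complex) ` {..n + degree y}"
  have P: "finite P" "card P = Suc (n + degree y)"
    by (auto simp: P_def card_image inj_on_def)
  obtain W where W: "finite W" "centralizer_upto n y \<subseteq> current.span W"
    using centralizer_upto_finite_span .
  have "z \<in> centralizer_upto n y"
    if z: "z \<in> takiff n" and *: "\<forall>t\<in>P. bracket (eval_current t y) (eval_current t z) = 0" for z
  proof -
    have "degree (current_bracket bracket y z) \<le> degree y + degree z"
      unfolding current_bracket_def
      by (intro degree_sum_le) (auto intro: order_trans[OF degree_monom_le])
    then have "current_bracket bracket y z = 0"
      using z P * by (intro eq_0_if_eval_current_eq_0[of P])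
        (auto simp: eval_current_bracket takiff_def)
    then show ?thesis
      using z by (simp add: mem_centralizer_upto takiff_def)
  qed
  then have "current.dim {z \<in> takiff n. \<forall>t\<in>P. bracket (eval_current t y) (eval_current t z) = 0}
      \<le> current.dim (centralizer_upto n y)"
    using W by (intro current.dim_mono_finite_span[of _ _ W]) auto
  then have "Suc n * dimension \<le> current.dim (centralizer_upto n y)
      + Suc (n + degree y) * (dimension - r)"
    using dim_evaluation_conditions[OF assms P(1), of n y] P(2) by simp
  moreover have "r \<le> dimension"
    using dim_bracket_image[of 0] assms[of 0] by linarith
  then have "Suc n * dimension = Suc n * r + Suc n * (dimension - r)"
    by (simp flip: distrib_left)
  moreover have "Suc (n + degree y) * (dimension - r)
      = Suc n * (dimension - r) + degree y * (dimension - r)"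
    by (simp add: distrib_right)
  ultimately show ?thesis
    by linarith
qed

text \<open>If \<open>dim E\<^sub>k < r\<close>, then \<open>dim E\<^sub>j \<le> r - 1\<close> for all \<open>j \<ge> k\<close>, and the sum formula makes \<open>dim Z\<^sub>n\<close>
  grow with slope at most \<open>r - 1\<close>. This contradicts the lower bound of slope \<open>r\<close> for large \<open>n\<close>.\<close>

lemma dim_centralizer_const_ge:
  assumes "\<And>a. r \<le> dim {z. bracket a z = 0}"
  shows "r \<le> dim (centralizer_const k y)"
proof (rule ccontr)
  let ?e = "\<lambda>j. dim (centralizer_const j y)"
  assume "\<not> r \<le> ?e k"
  then have small: "Suc (?e j) \<le> r" if "k \<le> j" for j
    using dim_centralizer_const_antimono[OF that, of y] by linarith
  \<comment> \<open>\<open>C\<close> bounds the initial terms of the sum together with the defect in the lower bound;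
    after more than \<open>C\<close> further steps the missing units outweigh both.\<close>
  define C where "C = k * dimension + degree y * (dimension - r)"
  have "(\<Sum>j\<le>k + i. ?e j) + i \<le> k * dimension + Suc i * r" for i
  proof (induction i)
    case 0
    have "(\<Sum>j<k. ?e j) \<le> (\<Sum>j<k. dimension)"
      by (intro sum_mono dim_subset_UNIV)
    then show ?case
      using small[of k] by (simp flip: lessThan_Suc_atMost)
  next
    case (Suc i)
    then show ?case
      using small[of "k + Suc i"] by simp
  qed
  from this[of "Suc C"] dim_centralizer_upto_ge[OF assms, of "k + Suc C" y]
  have "Suc (k + Suc C) * r + Suc C \<le> C + Suc (Suc C) * r"
    unfolding dim_centralizer_upto_eq_sum C_def by linarith
  moreover have "Suc (Suc C) * r \<le> Suc (k + Suc C) * r"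
    by (intro mult_right_mono) auto
  ultimately show False
    by linarith
qed

end

section \<open>The index and the modality\<close>

text \<open>For a non-degenerate invariant form \<open>K\<close>, the linear form \<open>K a\<close> has stabilizer equal to the centralizer of \<open>a\<close>: by invariance
  \<open>K a [y, z] = K [a, y] z\<close>, and this vanishes for all \<open>z\<close> only if \<open>[a, y] = 0\<close>.\<close>

lemma lie_index_le_dim_centralizer:
  assumes "quadratic_lie_algebra scale bracket"
  shows "lie_index scale bracket \<le> vector_space.dim scale {z. bracket a z = 0}"
proof -
  obtain K where Kl: "\<And>y. Vector_Spaces.linear scale (*) (\<lambda>x. K x y)"
    and K: "\<And>x. Vector_Spaces.linear scale (*) (K x)"
    "\<And>x. \<forall>y. K x y = 0 \<Longrightarrow> x = 0"
    "\<And>x y z. K (bracket x y) z = K x (bracket y z)"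
    using assms unfolding quadratic_lie_algebra_def by blast
  interpret complex_lie_algebra scale bracket
    using assms by (simp add: quadratic_lie_algebra_def)
  have "K 0 z = 0" for z
    using module_hom.zero[OF Kl[folded module_hom_iff_linear]] .
  then have "form_stabilizer bracket (K a) = {z. bracket a z = 0}"
    using K(2) by (auto simp: form_stabilizer_def simp flip: K(3))
  then show ?thesis
    unfolding lie_index_def using K(1)[of a] by (intro cINF_lower2[of _ _ "K a"]) auto
qed

theorem proposition1p5:
  fixes scale :: "complex \<Rightarrow> 'a::ab_group_add \<Rightarrow> 'a"
    and Basis :: "'a set"
    and bracket :: "'a \<Rightarrow> 'a \<Rightarrow> 'a"
    and m n :: nat
    and x :: "'a poly"
  assumes "finite_dimensional_vector_space scale Basis"
    and "quadratic_lie_algebra scale bracket"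
    and "m < n"
    and "modality scale bracket m n x = int ((n - m) * lie_index scale bracket)"
  shows "\<forall>n'\<ge>m. modality scale bracket m n' x = int ((n' - m) * lie_index scale bracket)"
proof (intro allI impI)
  fix n' assume n': "m \<le> n'"
  interpret finite_dimensional_lie_algebra scale Basis bracket
    using assms(1,2)
    by (simp add: finite_dimensional_lie_algebra_def quadratic_lie_algebra_def)
  define r where "r = lie_index scale bracket"
  define c where "c k y = current.dim (centralizer_upto k y)" for k y
  define e where "e k y = dim (centralizer_const k y)" for k y
  define L where "L = {y. takiff_proj m y = takiff_proj m x}"
  have r: "r \<le> e k y" for k y
    unfolding e_def r_def
    by (intro dim_centralizer_const_ge lie_index_le_dim_centralizer assms(2))
  have step: "c (m + i) y = c m y + (\<Sum>j\<in>{m<..m + i}. e j y)" for i y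
  proof (induction i)
    case (Suc i)
    have "{m<..m + Suc i} = insert (m + Suc i) {m<..m + i}" by auto
    then show ?case
      using Suc by (simp add: c_def e_def dim_centralizer_upto_Suc)
  qed simp
  have cm: "c m y = c m x" if "y \<in> L" for y
    using that by (simp add: c_def L_def)
  have mod: "modality scale bracket m k x = int (INF y\<in>L. c k y) - int (c m x)" for k
    by (simp add: modality_def c_def L_def)
  have ge: "c m x + (k - m) * r \<le> c k y" if "y \<in> L" "m \<le> k" for k y
  proof -
    have "(\<Sum>j\<in>{m<..k}. r) \<le> (\<Sum>j\<in>{m<..k}. e j y)"
      by (intro sum_mono r)
    then show ?thesis
      using step[of "k - m" y] that cm by simp
  qed
  have "L \<noteq> {}" by (auto simp: L_def)
  then have "(INF y\<in>L. c n y) \<in> (\<lambda>y. c n y) ` L"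
    by (intro Inf_nat_def1) auto
  then obtain y where y: "y \<in> L" "c n y = (INF y\<in>L. c n y)"
    by auto
  have cn: "c n y = c m x + (n - m) * r"
    using assms(4)[unfolded mod, folded r_def] y(2) by linarith
  \<comment> \<open>The increments between \<open>m\<close> and \<open>n\<close> are at least \<open>r\<close> and sum to \<open>(n - m) r\<close>, so none of them can
    exceed \<open>r\<close>; here \<open>m < n\<close> guarantees that there is one.\<close>
  have "e (Suc m) y \<le> r"
  proof (rule ccontr)
    assume *: "\<not> e (Suc m) y \<le> r"
    have "(\<Sum>j\<in>{m<..n}. r) < (\<Sum>j\<in>{m<..n}. e j y)"
      using r * assms(3) by (intro sum_strict_mono_ex1) (auto intro!: bexI[of _ "Suc m"])
    then show False
      using step[of "n - m" y] cn cm[OF y(1)] assms(3) by simp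
  qed
  then have er: "e j y = r" if "m < j" for j
    using r[of j y] dim_centralizer_const_antimono[of "Suc m" j y] that by (simp add: e_def)
  have "c n' y = c m x + (n' - m) * r"
    using step[of "n' - m" y] n' cm[OF y(1)] er by simp
  then have "(INF y\<in>L. c n' y) = c m x + (n' - m) * r"
    using y(1) ge n' by (intro cInf_eq_minimum) (auto intro: rev_image_eqI)
  then show "modality scale bracket m n' x = int ((n' - m) * lie_index scale bracket)"
    by (simp add: mod r_def)
qed

end
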